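(* Let $D$ be an integral domain and let $\tau_1$ and $\tau_2$ be relations on $D^{\#}$ such that $\tau_1\circ\tau_2\neq\emptyset$. (1) Suppose that $\tau_2$ is multiplicative on the left and that, for all $a,b,c\in D^{\#}$, if $a\,(\tau_1\circ\tau_2)\,c$ and $b\,(\tau_1\circ\tau_2)\,c$, then there exists $d\in D$ such that $a\,\tau_2\,d$, $b\,\tau_2\,d$ and $d\,\tau_1\,c$. Then $\tau_1\circ\tau_2$ is multiplicative on the left. (2) Suppose that $\tau_1$ is multiplicative on the right and that, for all $a,b,c\in D^{\#}$, if $a\,(\tau_1\circ\tau_2)\,b$ and $a\,(\tau_1\circ\tau_2)\,c$, then there exists $d\in D$ such that $a\,\tau_2\,d$, $d\,\tau_1\,b$ and $d\,\tau_1\,c$. Then $\tau_1\circ\tau_2$ is multiplicative on the right.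
   Context: For an integral domain $D$, $D^{\#}$ denotes the set of nonzero nonunit elements of $D$. A relation on $D^{\#}$ is a subset of $D^{\#}\times D^{\#}$ (not necessarily symmetric). Composition is defined by: $a\,(R_1\circ R_2)\,b$ if and only if there exists $c\in D^{\#}$ such that $a\,R_2\,c$ and $c\,R_1\,b$. A relation $\tau$ on $D^{\#}$ is multiplicative on the left if for all $a,b,c\in D^{\#}$, $a\,\tau\,c$ and $b\,\tau\,c$ imply $ab\,\tau\,c$; it is multiplicative on the right if for all $a,b,c\in D^{\#}$, $a\,\tau\,b$ and $a\,\tau\,c$ imply $a\,\tau\,bc$. *)

theory Defs
  imports Main
begin

definition nonzero_nonunits :: "'a::idom set" where
  "nonzero_nonunits = {x. x \<noteq> 0 \<and> \<not> x dvd 1}"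

definition relation_on_sharp :: "('a::idom \<times> 'a) set \<Rightarrow> bool" where
  "relation_on_sharp \<tau> \<longleftrightarrow> \<tau> \<subseteq> nonzero_nonunits \<times> nonzero_nonunits"

text \<open>The right-hand relation is applied first, i.e. in the opposite order to the library's
  relational composition \<open>O\<close>; see \<open>sharp_comp_eq_relcomp\<close> below.\<close>

definition sharp_comp ::
    "('a::idom \<times> 'a) set \<Rightarrow> ('a \<times> 'a) set \<Rightarrow> ('a \<times> 'a) set" (infixr "\<circ>\<^sub>#" 75) where
  "R1 \<circ>\<^sub># R2 = {(a, b). \<exists>c\<in>nonzero_nonunits. (a, c) \<in> R2 \<and> (c, b) \<in> R1}"

definition mult_left :: "('a::idom \<times> 'a) set \<Rightarrow> bool" where
  "mult_left \<tau> \<longleftrightarrow>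
     (\<forall>a\<in>nonzero_nonunits. \<forall>b\<in>nonzero_nonunits. \<forall>c\<in>nonzero_nonunits.
        (a, c) \<in> \<tau> \<longrightarrow> (b, c) \<in> \<tau> \<longrightarrow> (a * b, c) \<in> \<tau>)"

definition mult_right :: "('a::idom \<times> 'a) set \<Rightarrow> bool" where
  "mult_right \<tau> \<longleftrightarrow>
     (\<forall>a\<in>nonzero_nonunits. \<forall>b\<in>nonzero_nonunits. \<forall>c\<in>nonzero_nonunits.
        (a, b) \<in> \<tau> \<longrightarrow> (a, c) \<in> \<tau> \<longrightarrow> (a, b * c) \<in> \<tau>)"

lemma sharp_comp_eq_relcomp:
  assumes "relation_on_sharp R2"
  shows "R1 \<circ>\<^sub># R2 = R2 O R1"
  using assms unfolding sharp_comp_def relation_on_sharp_def by blast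

lemma relation_on_sharp_comp:
  assumes "relation_on_sharp R1" "relation_on_sharp R2"
  shows "relation_on_sharp (R1 \<circ>\<^sub># R2)"
  using assms unfolding sharp_comp_def relation_on_sharp_def by blast

end

theory Submission
  imports Defs
begin

text \<open>
  Two related pairs that agree in one component may a priori factor through different
  intermediate elements of the composition, and multiplicativity of a single factor says nothing
  about such pairs. The existence hypothesis supplies one intermediate element \<open>d\<close> that serves both
  pairs; the multiplicative factor then combines them over \<open>d\<close>, while the other factor is
  applied unchanged. Although \<open>d\<close> is only asked to lie in the domain, it is a nonzero nonunit because
  it is related to something by a relation on the nonzero nonunits, so it is admissible both in
  the multiplicativity condition and in the composition.
\<close>

theorem mainTheorem3:
  fixes \<tau>1 \<tau>2 :: "('a::idom \<times> 'a) set"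
  assumes "relation_on_sharp \<tau>1" and "relation_on_sharp \<tau>2"
    and "\<tau>1 \<circ>\<^sub># \<tau>2 \<noteq> {}"
  shows
    "(mult_left \<tau>2 \<and>
      (\<forall>a\<in>nonzero_nonunits. \<forall>b\<in>nonzero_nonunits. \<forall>c\<in>nonzero_nonunits.
         (a, c) \<in> \<tau>1 \<circ>\<^sub># \<tau>2 \<longrightarrow> (b, c) \<in> \<tau>1 \<circ>\<^sub># \<tau>2 \<longrightarrow>
         (\<exists>d::'a. (a, d) \<in> \<tau>2 \<and> (b, d) \<in> \<tau>2 \<and> (d, c) \<in> \<tau>1))
      \<longrightarrow> mult_left (\<tau>1 \<circ>\<^sub># \<tau>2)) \<and>
     (mult_right \<tau>1 \<and>
      (\<forall>a\<in>nonzero_nonunits. \<forall>b\<in>nonzero_nonunits. \<forall>c\<in>nonzero_nonunits.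
         (a, b) \<in> \<tau>1 \<circ>\<^sub># \<tau>2 \<longrightarrow> (a, c) \<in> \<tau>1 \<circ>\<^sub># \<tau>2 \<longrightarrow>
         (\<exists>d::'a. (a, d) \<in> \<tau>2 \<and> (d, b) \<in> \<tau>1 \<and> (d, c) \<in> \<tau>1))
      \<longrightarrow> mult_right (\<tau>1 \<circ>\<^sub># \<tau>2))"
proof (intro conjI impI; elim conjE)
  assume mult: "mult_left \<tau>2"
    and common: "\<forall>a\<in>nonzero_nonunits. \<forall>b\<in>nonzero_nonunits. \<forall>c\<in>nonzero_nonunits.
         (a, c) \<in> \<tau>1 \<circ>\<^sub># \<tau>2 \<longrightarrow> (b, c) \<in> \<tau>1 \<circ>\<^sub># \<tau>2 \<longrightarrow>
         (\<exists>d::'a. (a, d) \<in> \<tau>2 \<and> (b, d) \<in> \<tau>2 \<and> (d, c) \<in> \<tau>1)"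
  show "mult_left (\<tau>1 \<circ>\<^sub># \<tau>2)"
    unfolding mult_left_def
  proof (intro ballI impI)
    fix a b c :: 'a
    assume abc: "a \<in> nonzero_nonunits" "b \<in> nonzero_nonunits" "c \<in> nonzero_nonunits"
      and "(a, c) \<in> \<tau>1 \<circ>\<^sub># \<tau>2" "(b, c) \<in> \<tau>1 \<circ>\<^sub># \<tau>2"
    with common obtain d where d: "(a, d) \<in> \<tau>2" "(b, d) \<in> \<tau>2" "(d, c) \<in> \<tau>1"
      by blast
    have "d \<in> nonzero_nonunits"
      using d assms(2) unfolding relation_on_sharp_def by blast
    moreover from this have "(a * b, d) \<in> \<tau>2"
      using mult abc d unfolding mult_left_def by blast
    ultimately show "(a * b, c) \<in> \<tau>1 \<circ>\<^sub># \<tau>2"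
      using d unfolding sharp_comp_def by blast
  qed
next
  assume mult: "mult_right \<tau>1"
    and common: "\<forall>a\<in>nonzero_nonunits. \<forall>b\<in>nonzero_nonunits. \<forall>c\<in>nonzero_nonunits.
         (a, b) \<in> \<tau>1 \<circ>\<^sub># \<tau>2 \<longrightarrow> (a, c) \<in> \<tau>1 \<circ>\<^sub># \<tau>2 \<longrightarrow>
         (\<exists>d::'a. (a, d) \<in> \<tau>2 \<and> (d, b) \<in> \<tau>1 \<and> (d, c) \<in> \<tau>1)"
  show "mult_right (\<tau>1 \<circ>\<^sub># \<tau>2)"
    unfolding mult_right_def
  proof (intro ballI impI)
    fix a b c :: 'a
    assume abc: "a \<in> nonzero_nonunits" "b \<in> nonzero_nonunits" "c \<in> nonzero_nonunits"
      and "(a, b) \<in> \<tau>1 \<circ>\<^sub># \<tau>2" "(a, c) \<in> \<tau>1 \<circ>\<^sub># \<tau>2"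
    with common obtain d where d: "(a, d) \<in> \<tau>2" "(d, b) \<in> \<tau>1" "(d, c) \<in> \<tau>1"
      by blast
    have "d \<in> nonzero_nonunits"
      using d assms(1) unfolding relation_on_sharp_def by blast
    moreover from this have "(d, b * c) \<in> \<tau>1"
      using mult abc d unfolding mult_right_def by blast
    ultimately show "(a, b * c) \<in> \<tau>1 \<circ>\<^sub># \<tau>2"
      using d unfolding sharp_comp_def by blast
  qed
qed

end
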